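(* Consider the expected envy-free incentive mechanism described in the context, with agents $A=\{1,\dots,n\}$, evaluation functions $v_i$, initial routes $\mu_1,\dots,\mu_n$, assigned new routes $\eta_1,\dots,\eta_n$, adjustment incentives $a_1,\dots,a_n$ and payments $p_1,\dots,p_n$. Suppose that for every agent the expected evaluation of the new routes is at least that of the old routes, i.e. $$\frac1n\sum_{k=1}^n v_i(\eta_k)\ \ge\ \frac1n\sum_{k=1}^n v_i(\mu_k)\qquad\text{for all } i\in A.$$ Then the mechanism is expected individual rational, i.e. $$v_i(\eta_i)-\frac1n\sum_{k=1}^n v_i(\mu_k)-p_i\ \ge\ 0\qquad\text{for all } i\in A.$$
   Context: There are $n\ge1$ agents $A=\{1,\dots,n\}$ and a finite set of routes. Agent $i$ has an evaluation function $v_i$ assigning a real number $v_i(\rho)$ to each route $\rho$. Agent $i$ initially uses route $\mu_i$ and is assigned a new route $\eta_i$; the assignment $\eta$ maximizes $\sum_i v_i(\eta_i)$ among all assignments of agents to routes in which each route $\rho$ is used by a prescribed number of agents. For an arbitrary agent the initial route is treated as random, so agent $i$'s expected evaluation of an initial route is $E_{\mu}(v_i)=\frac1n\sum_{k=1}^n v_i(\mu_k)$, and likewise $E_{\eta}(v_i)=\frac1n\sum_{k=1}^n v_i(\eta_k)$. Given real adjustment incentives $a_1,\dots,a_n$, agent $i$'s expected evaluation of the new route assigned to agent $j$ is $E_{\mu}(e_{ij})=v_i(\eta_j)-E_{\mu}(v_i)+a_j$. The incentive mechanism determines, by a compensation procedure, adjustment incentives $a_1,\dots,a_n$ that are expected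 envy-free, i.e. $E_{\mu}(e_{ii})\ge E_{\mu}(e_{ij})$ for all $i,j\in A$. The total of the adjustment incentives is charged equally to all agents, so agent $i$'s payment is $p_i=\frac1n\sum_{j\in A}a_j-a_i$. Agent $i$'s expected utility is $E_{\mu}(u_i)=v_i(\eta_i)-E_{\mu}(v_i)-p_i$. *)

theory Defs
  imports Complex_Main
begin

text \<open>
  Agents are the numbers \<open>1..n\<close>; \<open>v i r\<close> is agent \<open>i\<close>'s evaluation of route \<open>r\<close>.
  A function \<open>nat \<Rightarrow> 'r\<close> is an assignment of routes; only its values on \<open>{1..n}\<close> matter.
\<close>

definition feasible_assignment ::
    "nat \<Rightarrow> 'r set \<Rightarrow> ('r \<Rightarrow> nat) \<Rightarrow> (nat \<Rightarrow> 'r) \<Rightarrow> bool" where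
  "feasible_assignment n R c \<xi> \<longleftrightarrow>
     (\<forall>i\<in>{1..n}. \<xi> i \<in> R) \<and> (\<forall>r\<in>R. card {i\<in>{1..n}. \<xi> i = r} = c r)"

definition optimal_assignment ::
    "nat \<Rightarrow> 'r set \<Rightarrow> ('r \<Rightarrow> nat) \<Rightarrow> (nat \<Rightarrow> 'r \<Rightarrow> real) \<Rightarrow> (nat \<Rightarrow> 'r) \<Rightarrow> bool" where
  "optimal_assignment n R c v \<eta> \<longleftrightarrow>
     is_arg_max (\<lambda>\<xi>. \<Sum>i=1..n. v i (\<xi> i)) (feasible_assignment n R c) \<eta>"

text \<open>
  The expected evaluation \<open>E\<^sub>\<xi>(w)\<close> of the route \<open>\<xi> k\<close> of an agent \<open>k\<close> drawn uniformly
  from \<open>{1..n}\<close>.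
\<close>

definition expected_evaluation :: "nat \<Rightarrow> (nat \<Rightarrow> 'r) \<Rightarrow> ('r \<Rightarrow> real) \<Rightarrow> real" where
  "expected_evaluation n \<xi> w = 1 / real n * (\<Sum>k=1..n. w (\<xi> k))"

text \<open>\<open>E\<^sub>\<mu>(e\<^sub>i\<^sub>j)\<close>: what agent \<open>i\<close> expects from the new route and the incentive of agent \<open>j\<close>.\<close>

definition expected_new_route_evaluation ::
    "nat \<Rightarrow> (nat \<Rightarrow> 'r \<Rightarrow> real) \<Rightarrow> (nat \<Rightarrow> 'r) \<Rightarrow> (nat \<Rightarrow> 'r) \<Rightarrow> (nat \<Rightarrow> real) \<Rightarrow>
       nat \<Rightarrow> nat \<Rightarrow> real" where
  "expected_new_route_evaluation n v \<mu> \<eta> a i j =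
     v i (\<eta> j) - expected_evaluation n \<mu> (v i) + a j"

definition expected_envy_free ::
    "nat \<Rightarrow> (nat \<Rightarrow> 'r \<Rightarrow> real) \<Rightarrow> (nat \<Rightarrow> 'r) \<Rightarrow> (nat \<Rightarrow> 'r) \<Rightarrow> (nat \<Rightarrow> real) \<Rightarrow> bool" where
  "expected_envy_free n v \<mu> \<eta> a \<longleftrightarrow>
     (\<forall>i\<in>{1..n}. \<forall>j\<in>{1..n}.
        expected_new_route_evaluation n v \<mu> \<eta> a i i \<ge>
        expected_new_route_evaluation n v \<mu> \<eta> a i j)"

definition payment :: "nat \<Rightarrow> (nat \<Rightarrow> real) \<Rightarrow> nat \<Rightarrow> real" where
  "payment n a i = 1 / real n * (\<Sum>j=1..n. a j) - a i"

definition expected_utility ::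
    "nat \<Rightarrow> (nat \<Rightarrow> 'r \<Rightarrow> real) \<Rightarrow> (nat \<Rightarrow> 'r) \<Rightarrow> (nat \<Rightarrow> 'r) \<Rightarrow> (nat \<Rightarrow> real) \<Rightarrow>
       nat \<Rightarrow> real" where
  "expected_utility n v \<mu> \<eta> a i =
     v i (\<eta> i) - expected_evaluation n \<mu> (v i) - payment n a i"

definition expected_individually_rational ::
    "nat \<Rightarrow> (nat \<Rightarrow> 'r \<Rightarrow> real) \<Rightarrow> (nat \<Rightarrow> 'r) \<Rightarrow> (nat \<Rightarrow> 'r) \<Rightarrow> (nat \<Rightarrow> real) \<Rightarrow> bool" where
  "expected_individually_rational n v \<mu> \<eta> a \<longleftrightarrow>
     (\<forall>i\<in>{1..n}. expected_utility n v \<mu> \<eta> a i \<ge> 0)"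

end

theory Submission
  imports Defs
begin

text \<open>
  Averaging agent \<open>i\<close>'s envy-freeness inequalities over all agents \<open>j\<close> shows that the equally
  shared charge \<open>1/n * (\<Sum>j. a j)\<close> is at most \<open>v i (\<eta> i) + a i\<close> minus the average of
  \<open>v i (\<eta> j)\<close>.  Hence the expected utility of \<open>i\<close> is at least the gain in expected evaluation
  from the old routes to the new ones.
\<close>

lemma expected_utility_ge_expected_gain:
  assumes "expected_envy_free n v \<mu> \<eta> a" and "i \<in> {1..n}"
  shows "expected_utility n v \<mu> \<eta> a i \<ge>
    expected_evaluation n \<eta> (v i) - expected_evaluation n \<mu> (v i)"
proof -
  have n: "real n > 0"
    using assms(2) by auto
  have "(\<Sum>j=1..n. v i (\<eta> j) + a j) \<le> (\<Sum>j=1..n. v i (\<eta> i) + a i)"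
  proof (rule sum_mono)
    fix j assume "j \<in> {1..n}"
    with assms have "expected_new_route_evaluation n v \<mu> \<eta> a i j
        \<le> expected_new_route_evaluation n v \<mu> \<eta> a i i"
      unfolding expected_envy_free_def by blast
    \<comment> \<open>The term \<open>expected_evaluation n \<mu> (v i)\<close> does not depend on
      \<open>j\<close>, so it cancels from both sides.\<close>
    then show "v i (\<eta> j) + a j \<le> v i (\<eta> i) + a i"
      by (simp add: expected_new_route_evaluation_def)
  qed
  then have "(\<Sum>j=1..n. v i (\<eta> j)) + (\<Sum>j=1..n. a j) \<le> real n * (v i (\<eta> i) + a i)"
    by (simp add: sum.distrib)
  then have "((\<Sum>j=1..n. v i (\<eta> j)) + (\<Sum>j=1..n. a j)) / real n \<le> v i (\<eta> i) + a i"
    using n by (simp add: pos_divide_le_eq mult.commute)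
  \<comment> \<open>In the utility, \<open>v i (\<eta> i)\<close> and the \<open>- a i\<close>
    inside the payment combine to \<open>v i (\<eta> i) + a i\<close>. Bounding this from below by
    the two averages cancels the shared charge.\<close>
  then show ?thesis
    by (simp add: expected_utility_def payment_def expected_evaluation_def add_divide_distrib)
qed

theorem theorem7:
  fixes n :: nat
    and R :: "'r set"
    and c :: "'r \<Rightarrow> nat"
    and v :: "nat \<Rightarrow> 'r \<Rightarrow> real"
    and \<mu> \<eta> :: "nat \<Rightarrow> 'r"
    and a :: "nat \<Rightarrow> real"
  assumes "n \<ge> 1"
    and "finite R"
    and "\<forall>i\<in>{1..n}. \<mu> i \<in> R"
    and "optimal_assignment n R c v \<eta>"
    and "expected_envy_free n v \<mu> \<eta> a"
    and "\<forall>i\<in>{1..n}. expected_evaluation n \<eta> (v i) \<ge> expected_evaluation n \<mu> (v i)"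
  shows "expected_individually_rational n v \<mu> \<eta> a"
  unfolding expected_individually_rational_def
proof
  fix i assume i: "i \<in> {1..n}"
  \<comment> \<open>The hypothesis comparing new with old routes makes the gain nonnegative.\<close>
  have "0 \<le> expected_evaluation n \<eta> (v i) - expected_evaluation n \<mu> (v i)"
    using assms(6) i by simp
  also have "\<dots> \<le> expected_utility n v \<mu> \<eta> a i"
    using assms(5) i by (rule expected_utility_ge_expected_gain)
  finally show "expected_utility n v \<mu> \<eta> a i \<ge> 0" .
qed

end
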